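(* The greedy projection (GP) and normalized greedy projection (NGP) methods locally converge to a solution $\boldsymbol x^*$ at a linear rate if $\mathrm{rank}(\boldsymbol U)=n$ and $\|\boldsymbol x^0-\boldsymbol x^*\|_2<\min(\delta,\delta')$. Here $\delta>0$ is the radius of some neighborhood $\{\boldsymbol x:\|\boldsymbol x-\boldsymbol x^*\|_2<\delta\}$ of $\boldsymbol x^*$, and $\delta'>0$ is another radius, which exists, such that whenever $\|\boldsymbol x^k-\boldsymbol x^*\|_2<\delta'$ the GP index rule is equivalent to $i_k=\arg\max_{1\le i\le m}\left|\nabla f_i(\boldsymbol x^* )^\top(\boldsymbol x^k-\boldsymbol x^* )\right|$ and the NGP index rule is equivalent to $i_k=\arg\max_{1\le i\le m}\left|\boldsymbol u_i^\top(\boldsymbol x^k-\boldsymbol x^* )\right|$. Specifically, let $\{\boldsymbol x^k\}_{k=1,2,\cdots}$ be the sequence generated by the NGP or GP. Then $$\|\boldsymbol x^k-\boldsymbol x^*\|_2<\gamma_{\mathrm{NGP}}^k\|\boldsymbol x^0-\boldsymbol x^*\|_2$$ for NGP and $$\|\boldsymbol x^k-\boldsymbol x^*\|_2<\gamma_{\mathrm{GP}}^k\|\boldsymbol x^0-\boldsymbol x^*\|_2$$ for GP, where $\gamma_{\mathrm{NGP}},\gamma_{\mathrm{GP}}\in(0,1)$ are the convergence rates of NGP and GP, respectively. Moreover, their asymptotic convergence rates are $$\lim_{k\to\infty}\gamma_{\mathrm{NGP}}=\sqrt{1-h_\infty^2(\boldsymbol U^\top)}\qquad\text{and}\qquad\lim_{k\to\infty}\gamma_{\mathrm{GP}}=\sqrt{1-\frac{h_\infty^2(\boldsymbol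 G^\top)}{\|\boldsymbol G^\top\|_{2,\infty}^2}},$$ where $h_\infty$ is the Hoffman type constant (the case $p=\infty$) defined by $$h_p(\boldsymbol U^\top)=\inf_{\boldsymbol v\ne\boldsymbol 0}\frac{\|\boldsymbol U^\top\boldsymbol v\|_p}{\|\boldsymbol v\|_2}$$ with $\|\cdot\|_p$ the $\ell_p$-norm ($1\le p\le\infty$), and likewise for $\boldsymbol G^\top$, and $\|\boldsymbol G^\top\|_{2,\infty}=\max_{1\le i\le m}\|\nabla f_i(\boldsymbol x^* )\|_2$.
   Context: Let $\boldsymbol f=(f_1,\dots,f_m)^\top:\mathbb{R}^n\to\mathbb{R}^m$ with real-valued components $f_i$, let $\mathcal S_i=\{\boldsymbol x\in\mathbb{R}^n: f_i(\boldsymbol x)=0\}$ (not necessarily convex), and let $\boldsymbol x^*\in\cap_{i=1}^m\mathcal S_i$ be a solution of $\boldsymbol f(\boldsymbol x)=\boldsymbol 0$. $\nabla f_i(\boldsymbol x^* )$ is the gradient of $f_i$ at $\boldsymbol x^*$, assumed nonzero for every $i$. $\Pi_i(\boldsymbol z)=\arg\min_{\boldsymbol x\in\mathcal S_i}\|\boldsymbol x-\boldsymbol z\|_2^2$ is the projection of $\boldsymbol z\in\mathbb{R}^n$ onto $\mathcal S_i$. Standing assumption: every $\Pi_i$, $i=1,\dots,m$, is differentiable at $\boldsymbol x^*$. Both methods iterate $\boldsymbol x^{k+1}=\Pi_{i_k}(\boldsymbol x^k)$, $k=0,1,\dots$. The GP index rule is $i_k=\arg\max_{1\le i\le m}|f_i(\boldsymbol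 x^k)|$; the NGP index rule is $i_k=\arg\max_{1\le i\le m}|f_i(\boldsymbol x^k)|/\|\nabla f_i(\boldsymbol x^* )\|_2$. Notation: $\boldsymbol u_i=\nabla f_i(\boldsymbol x^* )/\|\nabla f_i(\boldsymbol x^* )\|_2$; $\boldsymbol U=[\boldsymbol u_1,\dots,\boldsymbol u_m]\in\mathbb{R}^{n\times m}$; $\boldsymbol G=[\nabla f_1(\boldsymbol x^* ),\dots,\nabla f_m(\boldsymbol x^* )]\in\mathbb{R}^{n\times m}$. Convention on the asymptotic rate: the convergence rates $\gamma$ contain an arbitrarily small term $\epsilon>0$ that depends on the radius of the neighborhood of $\boldsymbol x^*$ and is regarded as tending to $0$ as the iterates approach $\boldsymbol x^*$; $\lim_{k\to\infty}\gamma$ is understood in this sense.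
   Formalization: Exact equivalence of the index rules within δ' fails (f=(x, y+y³), x*=0, at (t+t³/2, t)); it is replaced by equivalence up to a tolerance o(‖x−x*‖). The strict bounds are stated for k≥1 and x⁰≠x*, as they fail otherwise. *)

theory Defs
  imports "HOL-Analysis.Analysis"
begin

definition zero_set :: "(real^'n \<Rightarrow> real^'m) \<Rightarrow> 'm \<Rightarrow> (real^'n) set" where
  "zero_set f i = {x. f x $ i = 0}"

text \<open>\<open>S\<close> need not be convex, so nearest points need not be unique; a projection is any
  function choosing, for every \<open>z\<close>, a minimiser of the distance to \<open>z\<close> over \<open>S\<close>.\<close>

definition is_projection :: "'a::real_normed_vector set \<Rightarrow> ('a \<Rightarrow> 'a) \<Rightarrow> bool" where
  "is_projection S P \<longleftrightarrow> (\<forall>z. is_arg_min (\<lambda>x. (norm (x - z))\<^sup>2) (\<lambda>x. x \<in> S) (P z))"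

text \<open>The matrix with columns \<open>v i\<close>.\<close>

definition column_matrix :: "('m \<Rightarrow> real^'n) \<Rightarrow> real^'m^'n" where
  "column_matrix v = (\<chi> j i. v i $ j)"

definition lp_norm :: "ereal \<Rightarrow> real^'m \<Rightarrow> real" where
  "lp_norm p x = (if p = \<infinity> then infnorm x
     else (\<Sum>i\<in>UNIV. \<bar>x $ i\<bar> powr real_of_ereal p) powr (1 / real_of_ereal p))"

text \<open>Meaningful for \<open>1 \<le> p \<le> \<infinity>\<close>.\<close>

definition hoffman_const :: "ereal \<Rightarrow> real^'n^'m \<Rightarrow> real" where
  "hoffman_const p A = (INF v\<in>-{0}. lp_norm p (A *v v) / norm v)"

definition norm_2_inf :: "real^'n^'m \<Rightarrow> real" where
  "norm_2_inf A = (MAX i\<in>UNIV. norm (row i A))"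

text \<open>The index sequence is existentially quantified, so that ties between maximal indices may be
  broken arbitrarily. Below, \<open>g i\<close> is the gradient of the \<open>i\<close>-th component of \<open>f\<close> at the solution.\<close>

definition greedy_projection_sequence ::
    "('m \<Rightarrow> 'a \<Rightarrow> real) \<Rightarrow> ('m \<Rightarrow> 'a \<Rightarrow> 'a) \<Rightarrow> (nat \<Rightarrow> 'a) \<Rightarrow> bool" where
  "greedy_projection_sequence \<phi> P x \<longleftrightarrow>
     (\<exists>idx. \<forall>k. is_arg_max (\<lambda>i. \<phi> i (x k)) (\<lambda>_. True) (idx k) \<and> x (Suc k) = P (idx k) (x k))"

definition GP_sequence ::
    "(real^'n \<Rightarrow> real^'m) \<Rightarrow> ('m \<Rightarrow> real^'n \<Rightarrow> real^'n) \<Rightarrow> (nat \<Rightarrow> real^'n) \<Rightarrow> bool" where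
  "GP_sequence f P = greedy_projection_sequence (\<lambda>i z. \<bar>f z $ i\<bar>) P"

definition NGP_sequence ::
    "(real^'n \<Rightarrow> real^'m) \<Rightarrow> ('m \<Rightarrow> real^'n) \<Rightarrow> ('m \<Rightarrow> real^'n \<Rightarrow> real^'n) \<Rightarrow> (nat \<Rightarrow> real^'n) \<Rightarrow> bool"
  where
  "NGP_sequence f g P = greedy_projection_sequence (\<lambda>i z. \<bar>f z $ i\<bar> / norm (g i)) P"

text \<open>The selection rules ``maximise \<open>\<phi>\<close>'' and ``maximise \<open>\<psi>\<close>'' agree up to the tolerance \<open>\<tau>\<close>:
  a maximiser of either function maximises the other one up to \<open>\<tau>\<close>. For \<open>\<tau> = 0\<close> this says that
  both rules select exactly the same indices.\<close>

definition equivalent_rules :: "real \<Rightarrow> ('m \<Rightarrow> real) \<Rightarrow> ('m \<Rightarrow> real) \<Rightarrow> bool" where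
  "equivalent_rules \<tau> \<phi> \<psi> \<longleftrightarrow>
     (\<forall>i. is_arg_max \<phi> (\<lambda>_. True) i \<longrightarrow> (\<forall>j. \<psi> j \<le> \<psi> i + \<tau>)) \<and>
     (\<forall>i. is_arg_max \<psi> (\<lambda>_. True) i \<longrightarrow> (\<forall>j. \<phi> j \<le> \<phi> i + \<tau>))"

lemma equivalent_rules_0:
  "equivalent_rules 0 \<phi> \<psi> \<longleftrightarrow>
     (\<forall>i. is_arg_max \<phi> (\<lambda>_. True) i \<longleftrightarrow> is_arg_max \<psi> (\<lambda>_. True) i)"
  by (auto simp: equivalent_rules_def is_arg_max_linorder)

text \<open>Local linear convergence to \<open>xs\<close> from the open ball of radius \<open>R\<close>, with asymptotic rate \<open>L\<close>.
  The rate contains an error term depending on the radius of the neighbourhood the iteration starts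
  in, hence it is a function \<open>\<gamma>\<close> of that radius. Since a tail of an iteration is
  again an iteration, \<open>\<gamma> (norm (x k - xs))\<close> is the rate valid from the \<open>k\<close>-th iterate on. The strict
  error bound can only hold for \<open>k \<ge> 1\<close> and \<open>x 0 \<noteq> xs\<close>. The choice \<open>r = R\<close> gives one rate for the
  whole ball.\<close>

definition local_linear_convergence ::
    "((nat \<Rightarrow> 'a::real_normed_vector) \<Rightarrow> bool) \<Rightarrow> 'a \<Rightarrow> real \<Rightarrow> (real \<Rightarrow> real) \<Rightarrow> real \<Rightarrow> bool" where
  "local_linear_convergence iteration xs R \<gamma> L \<longleftrightarrow>
     (\<forall>r. 0 < r \<and> r \<le> R \<longrightarrow> 0 < \<gamma> r \<and> \<gamma> r < 1) \<and>
     (\<gamma> \<longlongrightarrow> L) (at_right 0) \<and>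
     (\<forall>x. iteration x \<and> norm (x 0 - xs) < R \<longrightarrow>
        x \<longlonglongrightarrow> xs \<and>
        (\<lambda>k. \<gamma> (norm (x k - xs))) \<longlonglongrightarrow> L \<and>
        (\<forall>r k. r \<le> R \<and> 0 < norm (x 0 - xs) \<and> norm (x 0 - xs) \<le> r \<and> 1 \<le> k \<longrightarrow>
           norm (x k - xs) < \<gamma> r ^ k * norm (x 0 - xs)))"

end

theory Submission
  imports Defs
begin

text \<open>
  Let \<open>v = x - xs\<close> be the error of the current iterate, and let \<open>D\<close> be the derivative at \<open>xs\<close> of the
  projection onto the zero set of a function with gradient \<open>a\<close>. To first order one step replaces
  \<open>v\<close> by \<open>D v\<close>. One might expect \<open>D\<close> to be the orthogonal projection onto the hyperplane normal to
  \<open>a\<close>, but differentiability of the function at the single point \<open>xs\<close> does not guarantee this: its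
  zero set may even be \<open>{xs}\<close>, and then \<open>D = 0\<close>. What always holds is that \<open>D\<close> maps into that
  hyperplane (the function vanishes along the projection, so \<open>a \<bullet> D v = 0\<close>) and that \<open>D v\<close> is a
  nearest point to \<open>v\<close> in the range of \<open>D\<close> (the first-order form of the minimality of the
  projection). Hence \<open>D v\<close> is orthogonal to \<open>v - D v\<close>, and Pythagoras and Cauchy--Schwarz give
  \<open>\<parallel>D v\<parallel>\<^sup>2 \<le> \<parallel>v\<parallel>\<^sup>2 - (a \<bullet> v)\<^sup>2 / \<parallel>a\<parallel>\<^sup>2\<close>; see \<open>projection_derivative_norm_le\<close>. An upper bound
  is all that convergence requires.

  The greedy index maximises \<open>\<bar>a i \<bullet> v\<bar>\<close> up to \<open>o(\<parallel>v\<parallel>)\<close>, and the largest of these numbers is the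
  maximum norm of the matrix with rows \<open>a i\<close> applied to \<open>v\<close>, hence at least \<open>h \<parallel>v\<parallel>\<close> with the Hoffman
  constant \<open>h\<close>. With \<open>M\<close> the largest of the norms \<open>\<parallel>a i\<parallel>\<close>, the error therefore shrinks by any
  factor larger than \<open>sqrt (1 - h\<^sup>2 / M\<^sup>2)\<close> once \<open>x\<close> is close enough to \<open>xs\<close>; see
  \<open>greedy_step_contracting\<close>. Full rank makes \<open>h\<close> positive, so this limit factor is below 1.

  The normalized method is the greedy method for the functions \<open>f\<^sub>i / \<parallel>g i\<parallel>\<close>, which have the same zero
  sets, and whose gradients are the unit vectors \<open>u i\<close>, so that \<open>M = 1\<close>. One theorem thus covers
  both methods.
\<close>

section \<open>Error terms as functions of the radius\<close>

text \<open>Turns ``every tolerance \<open>c > 0\<close> is achieved on some ball'' into a tolerance that is a function of the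
  radius and vanishes with it. Both the tolerance of the index rules and the excess of the
  contraction factor over its limit are obtained in this way. The function is the infimum of the
  tolerances achieved at radius \<open>r\<close>, plus \<open>r\<close>: the summand \<open>r\<close> avoids having to show that the
  infimum is achieved, and leaves the room from which the strict error bounds come.\<close>

lemma modulus_exists:
  fixes Q :: "real \<Rightarrow> real \<Rightarrow> bool"
  assumes ex: "\<And>c. 0 < c \<Longrightarrow> \<exists>r>0. Q c r"
    and anti: "\<And>c r s. Q c r \<Longrightarrow> s \<le> r \<Longrightarrow> Q c s"
  obtains R \<eta> where "0 < R" and "(\<eta> \<longlongrightarrow> 0) (at_right 0)"
    and "\<And>r. 0 < r \<Longrightarrow> r \<le> R \<Longrightarrow> \<exists>c. 0 < c \<and> c < \<eta> r \<and> Q c r"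
proof -
  obtain R where R: "0 < R" "Q 1 R"
    using ex[of 1] by auto
  define C where "C r = {c. 0 < c \<and> Q c r}" for r
  define \<eta> where "\<eta> r = Inf (C r) + r" for r
  have bdd: "bdd_below (C r)" for r
    unfolding C_def by (rule bdd_belowI[of _ 0]) auto
  have small: "\<exists>c. 0 < c \<and> c < \<eta> r \<and> Q c r" if "0 < r" "r \<le> R" for r
  proof -
    have "C r \<noteq> {}"
      using anti[OF R(2) that(2)] by (auto simp: C_def intro: exI[of _ 1])
    moreover have "Inf (C r) < \<eta> r"
      using that by (simp add: \<eta>_def)
    ultimately obtain c where "c \<in> C r" "c < \<eta> r"
      using cInf_lessD by blast
    then show ?thesis
      by (auto simp: C_def)
  qed
  have "(\<eta> \<longlongrightarrow> 0) (at_right 0)"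
  proof (rule tendstoI)
    fix e :: real
    assume "0 < e"
    then obtain s where s: "0 < s" "Q (e/2) s"
      using ex[of "e/2"] by auto
    have "dist (\<eta> r) 0 < e" if r: "0 < r" "r < Min {s, e/2, R}" for r
    proof -
      have "e/2 \<in> C r"
        using r \<open>0 < e\<close> anti[OF s(2), of r] by (simp add: C_def)
      then have "Inf (C r) \<le> e/2"
        by (rule cInf_lower) (rule bdd)
      moreover have "0 < \<eta> r"
        using small[of r] r by auto
      ultimately show ?thesis
        using r by (simp add: \<eta>_def)
    qed
    then show "\<forall>\<^sub>F r in at_right 0. dist (\<eta> r) 0 < e"
      unfolding eventually_at_right_field
      using s R \<open>0 < e\<close> by (intro exI[of _ "Min {s, e/2, R}"]) auto
  qed
  with R(1) small show thesis
    using that by blast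
qed

section \<open>Local linear convergence from contracting steps\<close>

lemma local_linear_convergence_subset:
  assumes "local_linear_convergence iteration xs R \<gamma> L" "R' \<le> R"
  shows "local_linear_convergence iteration xs R' \<gamma> L"
  using assms unfolding local_linear_convergence_def
  by (meson order.trans order.strict_trans2)

text \<open>The rate for starting points at distance \<open>r\<close> is \<open>L\<close> plus the excess function \<open>\<eta>\<close> provided by
  \<open>modulus_exists\<close>. A rate below 1 keeps all iterates in the ball of radius \<open>r\<close>, where the same
  contraction factor applies again.\<close>

lemma local_linear_convergence_if_contracting:
  fixes xs :: "'a::real_normed_vector"
  assumes L: "0 \<le> L" "L < 1"
    and fixed: "\<And>i. P i xs = xs"
    and contracting: "\<And>c. L < c \<Longrightarrow> \<exists>r>0. \<forall>x i. norm (x - xs) \<le> r \<longrightarrow>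
      is_arg_max (\<lambda>j. \<phi> j x) (\<lambda>_. True) i \<longrightarrow> norm (P i x - xs) \<le> c * norm (x - xs)"
  obtains R \<gamma> where "0 < R"
    and "local_linear_convergence (greedy_projection_sequence \<phi> P) xs R \<gamma> L"
proof -
  define Q where "Q c r \<longleftrightarrow> (\<forall>x i. norm (x - xs) \<le> r \<longrightarrow>
      is_arg_max (\<lambda>j. \<phi> j x) (\<lambda>_. True) i \<longrightarrow> norm (P i x - xs) \<le> (L + c) * norm (x - xs))"
    for c r
  obtain R0 \<eta> where R0: "0 < R0" and \<eta>: "(\<eta> \<longlongrightarrow> 0) (at_right 0)"
    and step: "\<And>r. 0 < r \<Longrightarrow> r \<le> R0 \<Longrightarrow> \<exists>c. 0 < c \<and> c < \<eta> r \<and> Q c r"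
  proof (rule modulus_exists)
    show "\<exists>r>0. Q c r" if "0 < c" for c
      unfolding Q_def using contracting[of "L + c"] that by simp
    show "Q c s" if "Q c r" "s \<le> r" for c r s
      using that unfolding Q_def by (meson order_trans)
  qed blast
  have "\<forall>\<^sub>F r in at_right 0. \<eta> r < 1 - L"
    using order_tendstoD(2)[OF \<eta>] L by simp
  then obtain b where b: "0 < b" "\<And>r. 0 < r \<Longrightarrow> r < b \<Longrightarrow> \<eta> r < 1 - L"
    unfolding eventually_at_right_field by auto
  define R where "R = min R0 (b/2)"
  have R: "0 < R" "R \<le> R0" "R < b"
    using R0 b(1) by (auto simp: R_def)
  \<comment> \<open>The value at \<open>0\<close> makes \<open>\<gamma>\<close> right-continuous there: an iteration may reach \<open>xs\<close> exactly, and
    its rates must then still converge to \<open>L\<close>.\<close>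
  define \<gamma> where "\<gamma> r = (if r = 0 then L else L + \<eta> r)" for r
  have \<gamma>_bounds: "0 < \<gamma> r" "\<gamma> r < 1" if "0 < r" "r \<le> R" for r
    using step[of r] b(2)[of r] that R L by (auto simp: \<gamma>_def)
  have "((\<lambda>r. L + \<eta> r) \<longlongrightarrow> L) (at_right 0)"
    using tendsto_add[OF tendsto_const[of L] \<eta>] by simp
  then have \<gamma>_lim: "(\<gamma> \<longlongrightarrow> L) (at_right 0)"
    by (rule Lim_transform_eventually)
       (auto simp: \<gamma>_def eventually_at_right_field intro: exI[of _ 1])
  have bound: "norm (x k - xs) \<le> \<gamma> r ^ k * norm (x 0 - xs) \<and>
      (1 \<le> k \<longrightarrow> norm (x k - xs) < \<gamma> r ^ k * norm (x 0 - xs))"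
    if seq: "greedy_projection_sequence \<phi> P x"
      and r: "0 < norm (x 0 - xs)" "norm (x 0 - xs) \<le> r" "r \<le> R" for x r k
  proof (induction k)
    case 0
    then show ?case by simp
  next
    case (Suc k)
    have "0 < r"
      using r by linarith
    then obtain c where c: "0 < c" "c < \<eta> r" "Q c r"
      using step[of r] r(3) R(2) by auto
    obtain i where i: "is_arg_max (\<lambda>j. \<phi> j (x k)) (\<lambda>_. True) i" "x (Suc k) = P i (x k)"
      using seq unfolding greedy_projection_sequence_def by blast
    have \<gamma>: "0 < \<gamma> r" "\<gamma> r < 1"
      using \<gamma>_bounds \<open>0 < r\<close> r(3) by auto
    have "norm (x k - xs) \<le> \<gamma> r ^ k * norm (x 0 - xs)"
      using Suc by blast
    also have "\<dots> \<le> 1 * norm (x 0 - xs)"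
      using \<gamma> by (intro mult_right_mono power_le_one) auto
    finally have "norm (x k - xs) \<le> r"
      using r by simp
    then have "norm (x (Suc k) - xs) \<le> (L + c) * norm (x k - xs)"
      using c(3) i unfolding Q_def by simp
    also have "\<dots> \<le> (L + c) * (\<gamma> r ^ k * norm (x 0 - xs))"
      using Suc L c(1) by (intro mult_left_mono) auto
    also have "\<dots> < \<gamma> r * (\<gamma> r ^ k * norm (x 0 - xs))"
      using c(2) \<open>0 < r\<close> \<gamma> r(1) by (intro mult_strict_right_mono) (auto simp: \<gamma>_def)
    finally show ?case
      by (simp add: mult.assoc)
  qed
  have conv: "x \<longlonglongrightarrow> xs" if seq: "greedy_projection_sequence \<phi> P x" and x0: "norm (x 0 - xs) < R" for x
  proof (cases "x 0 = xs")
    case True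
    have "x k = xs" for k
    proof (induction k)
      case (Suc k)
      obtain i where "x (Suc k) = P i (x k)"
        using seq unfolding greedy_projection_sequence_def by blast
      then show ?case
        using Suc fixed by simp
    qed (rule True)
    then show ?thesis
      by (intro tendsto_eventually always_eventually allI)
  next
    case False
    have "0 < \<gamma> R" "\<gamma> R < 1"
      using \<gamma>_bounds[of R] R(1) by auto
    then have "(\<lambda>k. \<gamma> R ^ k * norm (x 0 - xs)) \<longlonglongrightarrow> 0"
      by (intro tendsto_mult_left_zero LIMSEQ_realpow_zero less_imp_le)
    moreover have "\<forall>\<^sub>F k in sequentially. norm (x k - xs) \<le> \<gamma> R ^ k * norm (x 0 - xs)"
      using bound[OF seq, of R] x0 False by simp
    ultimately have "(\<lambda>k. x k - xs) \<longlonglongrightarrow> 0"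
      by (rule Lim_null_comparison[rotated])
    then show ?thesis
      by (rule LIM_zero_cancel)
  qed
  have rates: "(\<lambda>k. \<gamma> (norm (x k - xs))) \<longlonglongrightarrow> L" if "x \<longlonglongrightarrow> xs" for x
  proof -
    have \<gamma>_0: "\<gamma> 0 = L"
      by (simp add: \<gamma>_def)
    have "continuous (at 0 within {0..}) \<gamma>"
      unfolding continuous_within at_within_Ici_at_right \<gamma>_0 by (rule \<gamma>_lim)
    moreover have "(\<lambda>k. norm (x k - xs)) \<longlonglongrightarrow> 0"
      using that by (simp add: LIM_zero tendsto_norm_zero)
    ultimately have "(\<lambda>k. \<gamma> (norm (x k - xs))) \<longlonglongrightarrow> \<gamma> 0"
      unfolding continuous_within_sequentially comp_def by auto
    then show ?thesis
      by (simp only: \<gamma>_0)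
  qed
  have "local_linear_convergence (greedy_projection_sequence \<phi> P) xs R \<gamma> L"
    unfolding local_linear_convergence_def
    by (intro conjI allI impI; (elim conjE)?)
      (use \<gamma>_bounds \<gamma>_lim conv rates bound in blast)+
  with R(1) show thesis
    using that by blast
qed

section \<open>The derivative of a projection\<close>

lemma projection_fixes_points:
  assumes "is_projection S P" "x \<in> S"
  shows "P x = x"
  using assms unfolding is_projection_def is_arg_min_linorder
  by (metis diff_self norm_eq_zero norm_zero power_zero_numeral power2_less_eq_zero_iff right_minus_eq)

lemma projection_in_set: "is_projection S P \<Longrightarrow> P z \<in> S"
  unfolding is_projection_def is_arg_min_linorder by blast

lemma projection_nearest:
  assumes "is_projection S P" "y \<in> S"
  shows "norm (P z - z) \<le> norm (y - z)"
  using assms unfolding is_projection_def is_arg_min_linorder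
  by (meson norm_ge_zero power2_le_imp_le)

text \<open>Divide the inequality between \<open>\<parallel>P z - z\<parallel>\<close> and \<open>\<parallel>y - z\<parallel>\<close>, for \<open>z = xs + t v\<close> and the
  competitor \<open>y = P (xs + t w)\<close>, by \<open>t\<close> and let \<open>t\<close> tend to 0 from the right.\<close>

lemma projection_derivative_nearest:
  fixes P :: "'a::real_inner \<Rightarrow> 'a"
  assumes P: "is_projection S P" and xs: "xs \<in> S"
    and D: "(P has_derivative D) (at xs)"
  shows "norm (D v - v) \<le> norm (D w - v)"
proof -
  have lim: "((\<lambda>t. (P (xs + t *\<^sub>R w) - (xs + t *\<^sub>R v)) /\<^sub>R t) \<longlongrightarrow> D w - v) (at_right 0)" for w
  proof -
    have "((\<lambda>t. P (xs + t *\<^sub>R w)) has_derivative (\<lambda>t. D (t *\<^sub>R w))) (at 0)"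
      by (rule has_derivative_compose[where g = P and f = "\<lambda>t. xs + t *\<^sub>R w" and s = UNIV])
         (auto intro!: derivative_eq_intros D)
    then have "((\<lambda>t. P (xs + t *\<^sub>R w)) has_vector_derivative D w) (at 0)"
      using linear_scale[OF has_derivative_linear[OF D]] by (simp add: has_vector_derivative_def)
    then have "((\<lambda>t. P (xs + t *\<^sub>R w) - (xs + t *\<^sub>R v)) has_vector_derivative D w - v) (at 0)"
      by (auto intro!: derivative_eq_intros)
    then have "((\<lambda>t. P (xs + t *\<^sub>R w) - (xs + t *\<^sub>R v)) has_vector_derivative D w - v) (at_right 0)"
      by (rule has_vector_derivative_at_within)
    then have "((\<lambda>t. (P (xs + t *\<^sub>R w) - (xs + t *\<^sub>R v) - t *\<^sub>R (D w - v)) /\<^sub>R norm t) \<longlongrightarrow> 0) (at_right 0)"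
      using projection_fixes_points[OF P xs]
      by (simp add: has_vector_derivative_def has_derivative_at_within)
    then have "((\<lambda>t. (P (xs + t *\<^sub>R w) - (xs + t *\<^sub>R v)) /\<^sub>R t - (D w - v)) \<longlongrightarrow> 0) (at_right 0)"
      by (rule Lim_transform_eventually)
         (auto simp: eventually_at_right_field scaleR_diff_right scaleR_add_right intro: exI[of _ 1])
    then show ?thesis
      by (rule LIM_zero_cancel)
  qed
  show ?thesis
  proof (rule tendsto_le[OF _ tendsto_norm[OF lim[of w]] tendsto_norm[OF lim[of v]]])
    show "\<forall>\<^sub>F t in at_right 0. norm ((P (xs + t *\<^sub>R v) - (xs + t *\<^sub>R v)) /\<^sub>R t)
        \<le> norm ((P (xs + t *\<^sub>R w) - (xs + t *\<^sub>R v)) /\<^sub>R t)"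
      using projection_nearest[OF P projection_in_set[OF P]]
      by (intro always_eventually allI) (simp add: mult_left_mono)
  qed simp
qed

text \<open>This is Pythagoras for the decomposition of \<open>v\<close> into \<open>D v\<close> and \<open>v - D v\<close>: the parts are
  orthogonal because \<open>D v\<close> is nearest to \<open>v\<close> in the range of \<open>D\<close>, and the second part has the
  same component along \<open>a\<close> as \<open>v\<close>, because the range of \<open>D\<close> is orthogonal to \<open>a\<close>.\<close>

lemma projection_derivative_norm_le:
  fixes F :: "'a::real_inner \<Rightarrow> real"
  assumes P: "is_projection {x. F x = 0} P" and xs: "F xs = 0"
    and F: "GDERIV F xs :> a" and "a \<noteq> 0"
    and D: "(P has_derivative D) (at xs)"
  shows "(norm (D v))\<^sup>2 \<le> (norm v)\<^sup>2 - (a \<bullet> v)\<^sup>2 / (norm a)\<^sup>2"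
proof -
  have "(F has_derivative (\<lambda>h. h \<bullet> a)) (at (P xs))"
    using F projection_fixes_points[OF P] xs by (simp add: gderiv_def)
  from has_derivative_compose[OF D this] have "((\<lambda>x. F (P x)) has_derivative (\<lambda>v. D v \<bullet> a)) (at xs)" .
  moreover have "(\<lambda>x. F (P x)) = (\<lambda>x. 0)"
    using projection_in_set[OF P] by auto
  ultimately have "(\<lambda>v. D v \<bullet> a) = (\<lambda>v. 0)"
    using has_derivative_unique[of "\<lambda>x. F (P x)" "\<lambda>v. D v \<bullet> a" xs "\<lambda>v. 0"] by simp
  then have tangent: "a \<bullet> D v = 0"
    by (metis inner_commute)
  have lin: "linear D"
    by (rule has_derivative_linear[OF D])
  have le: "(norm (D v - v))\<^sup>2 \<le> (norm ((1 + t) *\<^sub>R D v - v))\<^sup>2" for t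
    using projection_derivative_nearest[OF P _ D, of v "(1 + t) *\<^sub>R v"] xs
    by (simp add: linear_scale[OF lin])
  have orth: "D v \<bullet> (D v - v) = 0"
  proof (rule ccontr)
    assume "\<not> ?thesis"
    moreover define q where "q = D v \<bullet> (D v - v)"
    ultimately have q: "q \<noteq> 0" by simp
    then have pos: "0 < D v \<bullet> D v"
      by (auto simp: q_def)
    have *: "0 \<le> 2 * t * q + t\<^sup>2 * (D v \<bullet> D v)" for t
      using le[of t] unfolding q_def power2_norm_eq_inner
      by (simp add: algebra_simps inner_commute power2_eq_square)
    \<comment> \<open>The choice of \<open>t\<close> minimises the quadratic polynomial in the previous line.\<close>
    have "0 \<le> - (q\<^sup>2 / (D v \<bullet> D v))"
      using *[of "- q / (D v \<bullet> D v)"] pos by (simp add: field_simps power2_eq_square)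
    then show False
      using q pos by (simp add: divide_le_0_iff zero_le_divide_iff)
  qed
  have "(norm v)\<^sup>2 = (norm (D v))\<^sup>2 + (norm (v - D v))\<^sup>2"
    using orth unfolding power2_norm_eq_inner by (simp add: algebra_simps inner_commute)
  moreover have "(a \<bullet> v)\<^sup>2 \<le> (norm a)\<^sup>2 * (norm (v - D v))\<^sup>2"
    using Cauchy_Schwarz_ineq[of a "v - D v"] tangent
    by (simp add: inner_diff_right power2_norm_eq_inner)
  ultimately show ?thesis
    using \<open>a \<noteq> 0\<close> by (simp add: field_simps)
qed

section \<open>Linearised selection rules\<close>

lemma gderiv_small_o:
  assumes F: "GDERIV F xs :> a" and xs: "F xs = 0" and "0 < e"
  shows "\<forall>\<^sub>F x in nhds xs. \<bar>F x - a \<bullet> (x - xs)\<bar> \<le> e * norm (x - xs)"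
  using F \<open>0 < e\<close> xs unfolding gderiv_def has_derivative_at_alt eventually_nhds_metric dist_norm
  by (simp add: inner_commute)

lemma argmax_perturbed:
  fixes \<phi> \<psi> :: "'m \<Rightarrow> real"
  assumes "\<And>j. \<bar>\<phi> j - \<psi> j\<bar> \<le> e" "is_arg_max \<phi> (\<lambda>_. True) i"
  shows "\<psi> j \<le> \<psi> i + 2 * e"
proof -
  have "\<phi> j \<le> \<phi> i"
    using assms(2) by (simp add: is_arg_max_linorder)
  then show ?thesis
    using assms(1)[of i] assms(1)[of j] by linarith
qed

text \<open>Linearising all functions with error at most \<open>c/2 \<parallel>x - xs\<parallel>\<close> costs a maximiser at most twice
  that error.\<close>

lemma greedy_rules_equivalent:
  fixes F :: "'m::finite \<Rightarrow> 'a::real_inner \<Rightarrow> real"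
  assumes F: "\<And>i. GDERIV (F i) xs :> a i" and xs: "\<And>i. F i xs = 0" and "0 < c"
  shows "\<exists>r>0. \<forall>x. norm (x - xs) \<le> r \<longrightarrow>
    equivalent_rules (c * norm (x - xs)) (\<lambda>i. \<bar>F i x\<bar>) (\<lambda>i. \<bar>a i \<bullet> (x - xs)\<bar>)"
proof -
  have "\<forall>\<^sub>F x in nhds xs. \<forall>i. \<bar>F i x - a i \<bullet> (x - xs)\<bar> \<le> c/2 * norm (x - xs)"
    using \<open>0 < c\<close> by (intro eventually_all_finite gderiv_small_o F xs) auto
  then obtain d where d: "0 < d" "\<And>x i. dist x xs < d \<Longrightarrow> \<bar>F i x - a i \<bullet> (x - xs)\<bar> \<le> c/2 * norm (x - xs)"
    unfolding eventually_nhds_metric by blast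
  have "equivalent_rules (c * norm (x - xs)) (\<lambda>i. \<bar>F i x\<bar>) (\<lambda>i. \<bar>a i \<bullet> (x - xs)\<bar>)"
    if "norm (x - xs) \<le> d/2" for x
  proof -
    have near: "\<bar>\<bar>F i x\<bar> - \<bar>a i \<bullet> (x - xs)\<bar>\<bar> \<le> c/2 * norm (x - xs)" for i
      using d(2)[of x i] d(1) that abs_triangle_ineq3[of "F i x" "a i \<bullet> (x - xs)"]
      by (simp add: dist_norm)
    then have near': "\<bar>\<bar>a i \<bullet> (x - xs)\<bar> - \<bar>F i x\<bar>\<bar> \<le> c/2 * norm (x - xs)" for i
      by (simp add: abs_minus_commute)
    show ?thesis
      unfolding equivalent_rules_def
      using argmax_perturbed[of "\<lambda>i. \<bar>F i x\<bar>", OF near]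
        argmax_perturbed[of "\<lambda>i. \<bar>a i \<bullet> (x - xs)\<bar>", OF near'] by auto
  qed
  then show ?thesis
    using d(1) by (intro exI[of _ "d/2"]) auto
qed

lemma equivalent_rules_mono:
  "equivalent_rules \<tau> \<phi> \<psi> \<Longrightarrow> \<tau> \<le> \<tau>' \<Longrightarrow> equivalent_rules \<tau>' \<phi> \<psi>"
  unfolding equivalent_rules_def by (meson add_left_mono order_trans)

section \<open>Contraction of a greedy step\<close>

text \<open>Ensures that the radicand \<open>1 - h\<^sup>2 / M\<^sup>2\<close> of the asymptotic rate is nonnegative.\<close>

lemma hoffman_bound_le_max_norm:
  fixes a :: "'m \<Rightarrow> 'a::euclidean_space"
  assumes "\<And>v. \<exists>i. h * norm v \<le> \<bar>a i \<bullet> v\<bar>" and "\<And>i. norm (a i) \<le> M"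
  shows "h \<le> M"
proof -
  obtain b :: 'a where b: "b \<in> Basis"
    using nonempty_Basis by blast
  then obtain i where "h \<le> \<bar>a i \<bullet> b\<bar>"
    using assms(1)[of b] by auto
  also have "\<dots> \<le> norm (a i)"
    using Cauchy_Schwarz_ineq2[of "a i" b] b by simp
  finally show ?thesis
    using assms(2)[of i] by simp
qed

text \<open>The differentiation errors \<open>e \<parallel>x - xs\<parallel>\<close> enter twice: the linearised selection loses \<open>2 e\<close> of the
  constant \<open>h\<close>, and the linearised projection adds \<open>e\<close> to the factor. The resulting factor \<open>q e\<close>
  is continuous in \<open>e\<close> and equals the asymptotic rate for \<open>e = 0\<close>, hence is below \<open>c\<close> for small
  \<open>e\<close>.\<close>

lemma greedy_step_contracting:
  fixes F :: "'m::finite \<Rightarrow> 'a::euclidean_space \<Rightarrow> real"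
  assumes xs: "\<And>i. F i xs = 0"
    and F: "\<And>i. GDERIV (F i) xs :> a i" and a: "\<And>i. a i \<noteq> 0"
    and P: "\<And>i. is_projection {x. F i x = 0} (P i)"
    and diff: "\<And>i. P i differentiable (at xs)"
    and h: "0 < h" "\<And>v. \<exists>i. h * norm v \<le> \<bar>a i \<bullet> v\<bar>"
    and M: "\<And>i. norm (a i) \<le> M"
    and c: "sqrt (1 - h\<^sup>2 / M\<^sup>2) < c"
  shows "\<exists>r>0. \<forall>x i. norm (x - xs) \<le> r \<longrightarrow> is_arg_max (\<lambda>j. \<bar>F j x\<bar>) (\<lambda>_. True) i \<longrightarrow>
    norm (P i x - xs) \<le> c * norm (x - xs)"
proof -
  have M_pos: "0 < M"
    using M a by (meson zero_less_norm_iff order_less_le_trans)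
  obtain D where D: "\<And>i. (P i has_derivative D i) (at xs)"
    using diff unfolding differentiable_def by metis
  define q where "q e = sqrt (1 - (h - 2 * e)\<^sup>2 / M\<^sup>2) + e" for e
  have "(q \<longlongrightarrow> sqrt (1 - (h - 2 * 0)\<^sup>2 / M\<^sup>2) + 0) (at_right 0)"
    unfolding q_def using M_pos by (intro tendsto_intros) auto
  then have "\<forall>\<^sub>F e in at_right 0. q e < c"
    using c by (intro order_tendstoD(2)) auto
  \<comment> \<open>The bound \<open>h / 2\<close> keeps \<open>h - 2 * e\<close> positive, so that lower bounds by it can be squared.\<close>
  moreover have "\<forall>\<^sub>F e in at_right 0. 0 < e \<and> e < h / 2"
    using h(1) by (auto simp: eventually_at_right_field intro!: exI[of _ "h / 2"])
  ultimately have "\<forall>\<^sub>F e in at_right 0. q e < c \<and> 0 < e \<and> e < h / 2"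
    by (rule eventually_conj)
  then obtain e where e: "q e < c" "0 < e" "e < h / 2"
    using eventually_happens' trivial_limit_at_right_real by (metis (no_types, lifting))
  have "\<forall>\<^sub>F x in nhds xs. norm (P i x - P i xs - D i (x - xs)) \<le> e * norm (x - xs)" for i
    using D[of i] e(2) unfolding has_derivative_at_alt eventually_nhds_metric dist_norm by blast
  then have "\<forall>\<^sub>F x in nhds xs. \<forall>i. norm (P i x - P i xs - D i (x - xs)) \<le> e * norm (x - xs)"
    by (rule eventually_all_finite)
  moreover have "\<forall>\<^sub>F x in nhds xs. \<forall>i. \<bar>F i x - a i \<bullet> (x - xs)\<bar> \<le> e * norm (x - xs)"
    using e(2) by (intro eventually_all_finite gderiv_small_o F xs)
  ultimately have "\<forall>\<^sub>F x in nhds xs. (\<forall>i. norm (P i x - P i xs - D i (x - xs)) \<le> e * norm (x - xs)) \<and>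
      (\<forall>i. \<bar>F i x - a i \<bullet> (x - xs)\<bar> \<le> e * norm (x - xs))"
    by (rule eventually_conj)
  then obtain d where d: "0 < d"
      "\<And>x i. dist x xs < d \<Longrightarrow> norm (P i x - P i xs - D i (x - xs)) \<le> e * norm (x - xs)"
      "\<And>x i. dist x xs < d \<Longrightarrow> \<bar>F i x - a i \<bullet> (x - xs)\<bar> \<le> e * norm (x - xs)"
    unfolding eventually_nhds_metric by blast
  have "norm (P i x - xs) \<le> c * norm (x - xs)"
    if x: "norm (x - xs) \<le> d/2" and i: "is_arg_max (\<lambda>j. \<bar>F j x\<bar>) (\<lambda>_. True) i" for x i
  proof -
    define v where "v = x - xs"
    have x': "dist x xs < d"
      using x d(1) by (simp add: dist_norm)
    obtain j where j: "h * norm v \<le> \<bar>a j \<bullet> v\<bar>"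
      using h(2) by blast
    have "\<bar>\<bar>F i x\<bar> - \<bar>a i \<bullet> v\<bar>\<bar> \<le> e * norm v" for i
      using d(3)[OF x', of i] abs_triangle_ineq3[of "F i x" "a i \<bullet> v"] by (simp add: v_def)
    from argmax_perturbed[OF this i, of j] j
    have chosen: "(h - 2 * e) * norm v \<le> \<bar>a i \<bullet> v\<bar>"
      by (simp add: algebra_simps)
    have "((h - 2 * e) * norm v)\<^sup>2 / M\<^sup>2 \<le> (a i \<bullet> v)\<^sup>2 / (norm (a i))\<^sup>2"
      using power_mono[OF chosen, of 2] power_mono[OF M[of i], of 2] e(3) a[of i] M_pos
      by (intro frac_le) auto
    then have "(h - 2 * e)\<^sup>2 / M\<^sup>2 * (norm v)\<^sup>2 \<le> (a i \<bullet> v)\<^sup>2 / (norm (a i))\<^sup>2"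
      by (simp add: power_mult_distrib)
    then have "(norm (D i v))\<^sup>2 \<le> (1 - (h - 2 * e)\<^sup>2 / M\<^sup>2) * (norm v)\<^sup>2"
      using projection_derivative_norm_le[OF P xs F a D, of i v]
      unfolding left_diff_distrib by linarith
    from real_le_rsqrt[OF this] have "norm (D i v) \<le> sqrt (1 - (h - 2 * e)\<^sup>2 / M\<^sup>2) * norm v"
      by (simp add: real_sqrt_mult)
    moreover have "norm (P i x - xs - D i v) \<le> e * norm v"
      using d(2)[OF x', of i] projection_fixes_points[OF P, of xs i] xs by (simp add: v_def)
    ultimately have "norm (P i x - xs) \<le> q e * norm v"
      using norm_triangle_ineq[of "D i v" "P i x - xs - D i v"] by (simp add: q_def algebra_simps)
    also have "\<dots> \<le> c * norm v"
      using e(1) by (intro mult_right_mono) auto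
    finally show ?thesis
      by (simp add: v_def)
  qed
  then show ?thesis
    using d(1) by (intro exI[of _ "d/2"]) auto
qed

section \<open>The Hoffman constant for the maximum norm\<close>

lemma transpose_column_matrix_mult: "(transpose (column_matrix a) *v v) $ i = a i \<bullet> v"
  by (simp add: column_matrix_def transpose_def matrix_vector_mult_def inner_vec_def)

lemma norm_2_inf_column_matrix:
  "norm_2_inf (transpose (column_matrix a)) = (MAX i. norm (a i))"
proof -
  have "row i (transpose (column_matrix a)) = a i" for i
    by (simp add: row_def transpose_def column_matrix_def vec_eq_iff)
  then show ?thesis
    by (simp add: norm_2_inf_def)
qed

lemma infnorm_attained: "\<exists>i. infnorm (x::real^'n) = \<bar>x $ i\<bar>"
proof -
  have "infnorm x \<in> range (\<lambda>i. \<bar>x $ i\<bar>)"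
    unfolding infnorm_cart by (subst cSup_eq_Max) (auto simp: full_SetCompr_eq intro!: Max_in)
  then show ?thesis by blast
qed

text \<open>An injective linear map between finite-dimensional spaces is bounded below, and all norms on
  the target are equivalent. This gives a positive lower bound for the quotients, which both makes
  the infimum meaningful and shows that it is positive.\<close>

lemma hoffman_const_infinity:
  fixes a :: "'m::finite \<Rightarrow> real^'n"
  assumes inj: "\<And>v. (\<And>i. a i \<bullet> v = 0) \<Longrightarrow> v = 0"
  defines "h \<equiv> hoffman_const \<infinity> (transpose (column_matrix a))"
  shows "0 < h" and "\<exists>i. h * norm v \<le> \<bar>a i \<bullet> v\<bar>"
proof -
  let ?A = "transpose (column_matrix a)"
  have h: "h = (INF v\<in>-{0}. infnorm (?A *v v) / norm v)"
    by (simp add: h_def hoffman_const_def lp_norm_def)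
  have "inj ((*v) ?A)"
    unfolding linear_injective_0[OF matrix_vector_mul_linear]
    using inj by (metis transpose_column_matrix_mult zero_index)
  then obtain B where B: "0 < B" "\<And>v. B * norm v \<le> norm (?A *v v)"
    using linear_inj_bounded_below_pos[OF matrix_vector_mul_linear] by blast
  define b where "b = B / sqrt (DIM(real^'m))"
  have b: "0 < b"
    using B(1) by (simp add: b_def)
  have lower: "b \<le> infnorm (?A *v v) / norm v" if "v \<in> -{0}" for v
  proof -
    have "B * norm v \<le> sqrt (DIM(real^'m)) * infnorm (?A *v v)"
      using B(2)[of v] norm_le_infnorm[of "?A *v v"] by simp
    then show ?thesis
      using that by (simp add: b_def field_simps)
  qed
  obtain w :: "real^'n" where "w \<in> -{0}"
    using nonzero_Basis nonempty_Basis by auto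
  then have "b \<le> h"
    unfolding h by (intro cINF_greatest lower) auto
  with b show "0 < h"
    by simp
  have "h * norm v \<le> infnorm (?A *v v)"
  proof (cases "v = 0")
    case False
    then have "h \<le> infnorm (?A *v v) / norm v"
      unfolding h by (intro cINF_lower bdd_belowI2[of _ b] lower) auto
    then show ?thesis
      using False by (simp add: field_simps)
  qed (simp add: infnorm_0)
  then show "\<exists>i. h * norm v \<le> \<bar>a i \<bullet> v\<bar>"
    using infnorm_attained[of "?A *v v"] by (metis transpose_column_matrix_mult)
qed

section \<open>Convergence of greedy projections\<close>

lemma greedy_projection_local_linear_convergence:
  fixes F :: "'m::finite \<Rightarrow> real^'n \<Rightarrow> real"
  assumes xs: "\<And>i. F i xs = 0"
    and F: "\<And>i. GDERIV (F i) xs :> a i" and a: "\<And>i. a i \<noteq> 0"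
    and P: "\<And>i. is_projection {x. F i x = 0} (P i)"
    and diff: "\<And>i. P i differentiable (at xs)"
    and inj: "\<And>v. (\<And>i. a i \<bullet> v = 0) \<Longrightarrow> v = 0"
  obtains R \<gamma> where "0 < R"
    and "local_linear_convergence (greedy_projection_sequence (\<lambda>i x. \<bar>F i x\<bar>) P) xs R \<gamma>
      (sqrt (1 - (hoffman_const \<infinity> (transpose (column_matrix a)))\<^sup>2 /
        (norm_2_inf (transpose (column_matrix a)))\<^sup>2))"
proof -
  let ?h = "hoffman_const \<infinity> (transpose (column_matrix a))"
  let ?M = "norm_2_inf (transpose (column_matrix a))"
  have h: "0 < ?h" "\<exists>i. ?h * norm v \<le> \<bar>a i \<bullet> v\<bar>" for v
    using hoffman_const_infinity[of a] inj by blast+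
  have M: "norm (a i) \<le> ?M" for i
    by (simp add: norm_2_inf_column_matrix)
  have "?h \<le> ?M"
    by (rule hoffman_bound_le_max_norm[OF h(2) M])
  with h(1) have "0 < ?h\<^sup>2 / ?M\<^sup>2" "?h\<^sup>2 / ?M\<^sup>2 \<le> 1"
    using power_mono[of ?h ?M 2] by (auto simp: divide_le_eq)
  then have L: "0 \<le> sqrt (1 - ?h\<^sup>2 / ?M\<^sup>2)" "sqrt (1 - ?h\<^sup>2 / ?M\<^sup>2) < 1"
    by auto
  have fixed: "P i xs = xs" for i
    using projection_fixes_points[OF P] xs by simp
  show thesis
  proof (rule local_linear_convergence_if_contracting[OF L])
    show "P i xs = xs" for i
      by (rule fixed)
    show "\<exists>r>0. \<forall>x i. norm (x - xs) \<le> r \<longrightarrow> is_arg_max (\<lambda>j. \<bar>F j x\<bar>) (\<lambda>_. True) i \<longrightarrow>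
        norm (P i x - xs) \<le> c * norm (x - xs)"
      if "sqrt (1 - ?h\<^sup>2 / ?M\<^sup>2) < c" for c
      by (rule greedy_step_contracting[OF xs F a P diff h M that])
  qed (rule that)
qed

theorem theorem4p4:
  fixes f :: "real^'n \<Rightarrow> real^'m"
    and xs :: "real^'n"
    and g u :: "'m \<Rightarrow> real^'n"
    and P :: "'m \<Rightarrow> real^'n \<Rightarrow> real^'n"
    and U G :: "real^'m^'n"
  assumes solution: "xs \<in> (\<Inter>i. zero_set f i)"
    and gradient: "\<And>i. GDERIV (\<lambda>x. f x $ i) xs :> g i"
    and gradient_nonzero: "\<And>i. g i \<noteq> 0"
    and projection: "\<And>i. is_projection (zero_set f i) (P i)"
    and projection_differentiable: "\<And>i. P i differentiable (at xs)"
    and u: "\<And>i. u i = g i /\<^sub>R norm (g i)"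
    and U: "U = column_matrix u"
    and G: "G = column_matrix g"
    and full_rank: "rank U = CARD('n)"
  shows "\<exists>\<delta>>0. \<exists>\<delta>'>0. \<exists>\<gamma>_NGP \<gamma>_GP \<epsilon>.
    (\<epsilon> \<longlongrightarrow> 0) (at_right 0) \<and>
    (\<forall>x. norm (x - xs) < \<delta>' \<longrightarrow>
       equivalent_rules (\<epsilon> (norm (x - xs)) * norm (x - xs))
         (\<lambda>i. \<bar>f x $ i\<bar>) (\<lambda>i. \<bar>g i \<bullet> (x - xs)\<bar>) \<and>
       equivalent_rules (\<epsilon> (norm (x - xs)) * norm (x - xs))
         (\<lambda>i. \<bar>f x $ i\<bar> / norm (g i)) (\<lambda>i. \<bar>u i \<bullet> (x - xs)\<bar>)) \<and>
    local_linear_convergence (NGP_sequence f g P) xs (min \<delta> \<delta>') \<gamma>_NGP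
      (sqrt (1 - (hoffman_const \<infinity> (transpose U))\<^sup>2)) \<and>
    local_linear_convergence (GP_sequence f P) xs (min \<delta> \<delta>') \<gamma>_GP
      (sqrt (1 - (hoffman_const \<infinity> (transpose G))\<^sup>2 / (norm_2_inf (transpose G))\<^sup>2))"
proof -
  let ?F = "\<lambda>i x. f x $ i" and ?N = "\<lambda>i x. f x $ i / norm (g i)"
  have f_xs: "f xs $ i = 0" for i
    using solution by (auto simp: zero_set_def)
  have u_nonzero: "u i \<noteq> 0" and norm_u: "norm (u i) = 1" for i
    using gradient_nonzero[of i] by (auto simp: u)
  have gradient_N: "GDERIV (?N i) xs :> u i" for i
  proof -
    have "((\<lambda>x. inverse (norm (g i)) * f x $ i) has_derivative
        (\<lambda>h. inverse (norm (g i)) * (h \<bullet> g i))) (at xs)"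
      using gradient[of i] unfolding gderiv_def by (rule has_derivative_mult_right)
    then show ?thesis
      by (simp add: gderiv_def u field_simps)
  qed
  have projection_F: "is_projection {x. ?F i x = 0} (P i)" for i
    using projection[of i] by (simp add: zero_set_def)
  have projection_N: "is_projection {x. ?N i x = 0} (P i)" for i
    using projection_F[of i] gradient_nonzero[of i] by simp
  have inj_u: "v = 0" if "\<And>i. u i \<bullet> v = 0" for v
  proof -
    have "transpose U *v v = 0"
      using that by (simp add: vec_eq_iff U transpose_column_matrix_mult del: transpose_matrix_vector)
    moreover have "inj ((*v) (transpose U))"
      using full_rank by (simp add: full_rank_injective[symmetric] rank_transpose del: transpose_matrix_vector)
    ultimately show "v = 0"
      by (metis injD matrix_vector_mult_0_right)
  qed
  have inj_g: "v = 0" if "\<And>i. g i \<bullet> v = 0" for v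
    using that by (intro inj_u) (simp add: u)
  \<comment> \<open>The unit gradients make the denominator in the rate of the normalized method disappear.\<close>
  have norm_U: "norm_2_inf (transpose U) = 1"
    by (simp add: U norm_2_inf_column_matrix norm_u)
  have abs_N: "(\<lambda>i x. \<bar>?N i x\<bar>) = (\<lambda>i x. \<bar>f x $ i\<bar> / norm (g i))"
    by simp
  have f_xs_N: "?N i xs = 0" for i
    by (simp add: f_xs)
  obtain R1 \<gamma>_NGP where R1: "0 < R1"
    "local_linear_convergence (NGP_sequence f g P) xs R1 \<gamma>_NGP
      (sqrt (1 - (hoffman_const \<infinity> (transpose U))\<^sup>2))"
    using greedy_projection_local_linear_convergence[of ?N xs u P,
        OF f_xs_N gradient_N u_nonzero projection_N projection_differentiable inj_u,
        folded U, unfolded norm_U abs_N, folded NGP_sequence_def]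
    unfolding power_one div_by_1 by blast
  obtain R2 \<gamma>_GP where R2: "0 < R2"
    "local_linear_convergence (GP_sequence f P) xs R2 \<gamma>_GP
      (sqrt (1 - (hoffman_const \<infinity> (transpose G))\<^sup>2 / (norm_2_inf (transpose G))\<^sup>2))"
    using greedy_projection_local_linear_convergence[of ?F xs g P,
        OF f_xs gradient gradient_nonzero projection_F projection_differentiable inj_g,
        folded G GP_sequence_def]
    by blast
  define Q where "Q c r \<longleftrightarrow> (\<forall>x. norm (x - xs) \<le> r \<longrightarrow>
      equivalent_rules (c * norm (x - xs)) (\<lambda>i. \<bar>?F i x\<bar>) (\<lambda>i. \<bar>g i \<bullet> (x - xs)\<bar>) \<and>
      equivalent_rules (c * norm (x - xs)) (\<lambda>i. \<bar>?N i x\<bar>) (\<lambda>i. \<bar>u i \<bullet> (x - xs)\<bar>))" for c r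
  obtain R3 \<epsilon> where R3: "0 < R3" and \<epsilon>: "(\<epsilon> \<longlongrightarrow> 0) (at_right 0)"
    and rules: "\<And>r. 0 < r \<Longrightarrow> r \<le> R3 \<Longrightarrow> \<exists>c. 0 < c \<and> c < \<epsilon> r \<and> Q c r"
  proof (rule modulus_exists)
    show "\<exists>r>0. Q c r" if c: "0 < c" for c
    proof -
      obtain r1 where r1: "0 < r1" "\<And>x. norm (x - xs) \<le> r1 \<Longrightarrow>
          equivalent_rules (c * norm (x - xs)) (\<lambda>i. \<bar>?F i x\<bar>) (\<lambda>i. \<bar>g i \<bullet> (x - xs)\<bar>)"
        using greedy_rules_equivalent[of ?F xs g, OF gradient f_xs c] by blast
      obtain r2 where r2: "0 < r2" "\<And>x. norm (x - xs) \<le> r2 \<Longrightarrow>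
          equivalent_rules (c * norm (x - xs)) (\<lambda>i. \<bar>?N i x\<bar>) (\<lambda>i. \<bar>u i \<bullet> (x - xs)\<bar>)"
        using greedy_rules_equivalent[of ?N xs u, OF gradient_N f_xs_N c] unfolding abs_N by blast
      show ?thesis
        unfolding Q_def using r1 r2 by (intro exI[of _ "min r1 r2"]) simp
    qed
    show "Q c s" if "Q c r" "s \<le> r" for c r s
      using that unfolding Q_def by (meson order_trans)
  qed blast
  define R where "R = min R1 (min R2 R3)"
  have R: "0 < R" "R \<le> R1" "R \<le> R2" "R \<le> R3"
    using R1(1) R2(1) R3 by (auto simp: R_def)
  have rules_R: "equivalent_rules (\<epsilon> (norm (x - xs)) * norm (x - xs))
         (\<lambda>i. \<bar>f x $ i\<bar>) (\<lambda>i. \<bar>g i \<bullet> (x - xs)\<bar>) \<and>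
       equivalent_rules (\<epsilon> (norm (x - xs)) * norm (x - xs))
         (\<lambda>i. \<bar>f x $ i\<bar> / norm (g i)) (\<lambda>i. \<bar>u i \<bullet> (x - xs)\<bar>)"
    if near: "norm (x - xs) < R" for x
  proof (cases "x = xs")
    case True
    then show ?thesis
      by (simp add: equivalent_rules_def f_xs)
  next
    case False
    then obtain c where c: "c < \<epsilon> (norm (x - xs))" "Q c (norm (x - xs))"
      using rules[of "norm (x - xs)"] near R(4) by auto
    have "c * norm (x - xs) \<le> \<epsilon> (norm (x - xs)) * norm (x - xs)"
      using c(1) by (intro mult_right_mono) auto
    moreover have "equivalent_rules (c * norm (x - xs)) (\<lambda>i. \<bar>f x $ i\<bar>) (\<lambda>i. \<bar>g i \<bullet> (x - xs)\<bar>)"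
      "equivalent_rules (c * norm (x - xs)) (\<lambda>i. \<bar>f x $ i\<bar> / norm (g i)) (\<lambda>i. \<bar>u i \<bullet> (x - xs)\<bar>)"
      using c(2) by (auto simp: Q_def)
    ultimately show ?thesis
      using equivalent_rules_mono by blast
  qed
  have all: "(\<epsilon> \<longlongrightarrow> 0) (at_right 0) \<and>
    (\<forall>x. norm (x - xs) < R \<longrightarrow>
       equivalent_rules (\<epsilon> (norm (x - xs)) * norm (x - xs))
         (\<lambda>i. \<bar>f x $ i\<bar>) (\<lambda>i. \<bar>g i \<bullet> (x - xs)\<bar>) \<and>
       equivalent_rules (\<epsilon> (norm (x - xs)) * norm (x - xs))
         (\<lambda>i. \<bar>f x $ i\<bar> / norm (g i)) (\<lambda>i. \<bar>u i \<bullet> (x - xs)\<bar>)) \<and>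
    local_linear_convergence (NGP_sequence f g P) xs (min R R) \<gamma>_NGP
      (sqrt (1 - (hoffman_const \<infinity> (transpose U))\<^sup>2)) \<and>
    local_linear_convergence (GP_sequence f P) xs (min R R) \<gamma>_GP
      (sqrt (1 - (hoffman_const \<infinity> (transpose G))\<^sup>2 / (norm_2_inf (transpose G))\<^sup>2))"
    unfolding min.idem
    by (intro conjI allI impI \<epsilon> rules_R[THEN conjunct1] rules_R[THEN conjunct2]
        local_linear_convergence_subset[OF R1(2) R(2)]
        local_linear_convergence_subset[OF R2(2) R(3)])
  show ?thesis
    by (rule exI[of _ R], rule conjI[OF R(1)], rule exI[of _ R], rule conjI[OF R(1)],
        rule exI[of _ \<gamma>_NGP], rule exI[of _ \<gamma>_GP], rule exI[of _ \<epsilon>], rule all)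
qed

end
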